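(* Both $p(2n)$ and $p(2n+1)$ take each value of parity infinitely often; that is, each of the following four sets is infinite: the set of positive integers $n$ with $p(2n)$ even, the set of positive integers $n$ with $p(2n)$ odd, the set of positive integers $n$ with $p(2n+1)$ even, and the set of positive integers $n$ with $p(2n+1)$ odd.
   Context: A partition of a positive integer $n$ is a nonincreasing list of positive integers (called parts) that sum to $n$. The partition function $p(n)$ is the number of partitions of $n$. *)

theory Defs
  imports Main
begin

definition is_partition :: "nat \<Rightarrow> nat list \<Rightarrow> bool" where
  "is_partition n xs \<longleftrightarrow> sorted_wrt (\<ge>) xs \<and> (\<forall>x\<in>set xs. x > 0) \<and> sum_list xs = n"

(* By finite_partitions below, card does not take its default value on an infinite set;
   for n = 0 only the empty list qualifies, giving the usual p(0) = 1. *)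
definition partition_number :: "nat \<Rightarrow> nat" where
  "partition_number n = card {xs. is_partition n xs}"

lemma finite_partitions: "finite {xs. is_partition n xs}"
proof (rule finite_subset)
  have len: "length xs \<le> sum_list xs" if "\<forall>x\<in>set xs. x > 0" for xs :: "nat list"
    using that by (induction xs) auto
  show "{xs. is_partition n xs} \<subseteq> {xs. set xs \<subseteq> {..n} \<and> length xs \<le> n}"
    using len member_le_sum_list unfolding is_partition_def by fastforce
  show "finite {xs. set xs \<subseteq> {..n} \<and> length xs \<le> n}"
    by (rule finite_lists_length_le) simp
qed

lemma partition_number_0: "partition_number 0 = 1"
proof -
  have "{xs. is_partition 0 xs} = {[]}"
    by (auto simp: is_partition_def) (metis list.set_intros(1) neq_Nil_conv less_irrefl)
  then show ?thesis by (simp add: partition_number_def)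
qed

end

theory Submission
  imports Defs "HOL-Library.Z2" "HOL-Computational_Algebra.Formal_Power_Series"
begin

unbundle fps_syntax

text \<open>
  Let P be the generating function of the partition numbers modulo 2 and F the sum of
  q^(j(3j+1)/2) over all integers j. Euler's recurrence gives PF = 1, hence
  P F^2 = F, and F(q)^2 = F(q^2) modulo 2. Extracting the exponents congruent to r modulo 2,
  the generating function A of p(2n + r) satisfies A F = D, where the coefficient of q^n in D is
  1 iff 2n + r is pentagonal, which forces 48n + 24r + 1 to be a square.
  If p(2n + r) is odd only finitely often, then A is a polynomial; if it is even only finitely
  often, then (1 - q) A is. As the gaps between pentagonal numbers grow, a nonzero polynomial of
  degree N times F has coefficient 1 at N + k(3k + 1)/2 for every large k. Choosing k suitably modulo
  5 and modulo 11 makes two prescribed quadratics in k nonsquares at once, a contradiction.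
\<close>

section \<open>Euler's recurrence modulo 2 by an involution on pairs\<close>

definition hd0 :: "nat list \<Rightarrow> nat" where
  "hd0 xs = (case xs of [] \<Rightarrow> 0 | x # _ \<Rightarrow> x)"

text \<open>The sign-reversing involution of Bressoud and Zeilberger for Euler's recurrence.\<close>

definition bz :: "int \<times> nat list \<Rightarrow> int \<times> nat list" where
  "bz = (\<lambda>(j, xs).
     if int (hd0 xs) \<le> int (length xs) + 3 * j
     then (j - 1, filter (\<lambda>x. x > 0) (nat (int (length xs) + 3 * j - 1) # map (\<lambda>x. x - 1) xs))
     else (j + 1, map Suc (tl xs) @
            replicate (nat (int (hd0 xs) - 3 * j - 2) - length (tl xs)) 1))"

text \<open>These pairs count the coefficient of q^n in the product PF. The equation is doubled to
  avoid dividing j(3j + 1) by 2.\<close>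

definition bz_pairs :: "nat \<Rightarrow> (int \<times> nat list) set" where
  "bz_pairs n = {(j, xs). \<exists>i. is_partition i xs \<and> 2 * int i + j * (3 * j + 1) = 2 * int n}"

text \<open>Ones come last in a nonincreasing list, so lowering all parts and dropping zeros loses
  only their number, which the old length restores. This inverts the first branch of
  \<open>bz\<close>.\<close>

lemma restore_ones:
  assumes "sorted_wrt (\<ge>) xs" "\<forall>x\<in>set xs. x > (0::nat)"
  defines "ys \<equiv> filter (\<lambda>x. x > 0) (map (\<lambda>x. x - 1) xs)"
  shows "map Suc ys @ replicate (length xs - length ys) 1 = xs"
  using assms(1,2) unfolding ys_def
proof (induction xs)
  case (Cons a xs)
  show ?case
  proof (cases "a = 1")
    case True
    then have "\<forall>x\<in>set xs. x = 1" using Cons.prems by force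
    then have "filter (\<lambda>x. x > 0) (map (\<lambda>x. x - 1) xs) = []" and "replicate (length xs) 1 = xs"
      by (auto simp: filter_empty_conv replicate_length_same)
    with True show ?thesis by simp
  next
    case False
    with Cons.prems have "a > 1" by auto
    with Cons show ?thesis by simp
  qed
qed simp

lemma hd0_ge: "sorted_wrt (\<ge>) xs \<Longrightarrow> x \<in> set xs \<Longrightarrow> x \<le> hd0 xs"
  by (cases xs) (auto simp: hd0_def)

lemma sum_list_filter_pos: "sum_list (filter (\<lambda>x. x > 0) xs) = sum_list (xs :: nat list)"
  by (induction xs) auto

lemma sum_list_pred:
  "\<forall>x\<in>set xs. x > (0::nat) \<Longrightarrow> sum_list (map (\<lambda>x. x - 1) xs) + length xs = sum_list xs"
  by (induction xs) auto

lemma sum_list_map_Suc: "sum_list (map Suc xs) = sum_list xs + length xs"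
  by (induction xs) auto

lemma hd0_sum_tl: "hd0 xs + sum_list (tl xs) = sum_list xs"
  by (cases xs) (auto simp: hd0_def)

text \<open>The hypothesis \<open>ne\<close> excludes the pair (0, []), for which the new first part
  would be -1 and \<open>nat\<close> would truncate it.\<close>

lemma bz_down:
  assumes xs: "sorted_wrt (\<ge>) xs" "\<forall>x\<in>set xs. x > 0"
    and le: "int (hd0 xs) \<le> int (length xs) + 3 * j"
    and ne: "xs \<noteq> [] \<or> j \<noteq> 0"
  defines "ys \<equiv> snd (bz (j, xs))"
  shows "fst (bz (j, xs)) = j - 1"
    and "sorted_wrt (\<ge>) ys" and "\<forall>x\<in>set ys. x > 0"
    and "int (sum_list ys) = int (sum_list xs) + 3 * j - 1"
    and "bz (bz (j, xs)) = (j, xs)"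
proof -
  define m where "m = nat (int (length xs) + 3 * j - 1)"
  define zs where "zs = filter (\<lambda>x. x > 0) (map (\<lambda>x. x - 1) xs)"
  have m: "int m = int (length xs) + 3 * j - 1"
  proof (cases xs)
    case Nil
    then show ?thesis using le ne by (simp add: m_def hd0_def)
  next
    case (Cons a as)
    then have "hd0 xs > 0" using xs by (simp add: hd0_def)
    then show ?thesis using le by (simp add: m_def)
  qed
  have bz: "bz (j, xs) = (j - 1, filter (\<lambda>x. x > 0) (m # map (\<lambda>x. x - 1) xs))"
    using le by (simp add: bz_def m_def)
  have ys: "ys = filter (\<lambda>x. x > 0) (m # map (\<lambda>x. x - 1) xs)"
    using bz by (simp add: ys_def)
  have bz': "bz (j, xs) = (j - 1, ys)" using bz ys by simp
  show "fst (bz (j, xs)) = j - 1" using bz by simp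
  have mge: "x - 1 \<le> m" if "x \<in> set xs" for x
    using hd0_ge[OF xs(1) that] le m by linarith
  have "sorted_wrt (\<ge>) (map (\<lambda>x. x - 1) xs)"
    unfolding sorted_wrt_map by (rule sorted_wrt_mono_rel[OF _ xs(1)]) auto
  then have "sorted_wrt (\<ge>) (m # map (\<lambda>x. x - 1) xs)" using mge by auto
  then show "sorted_wrt (\<ge>) ys" unfolding ys by (rule sorted_wrt_filter)
  show "\<forall>x\<in>set ys. x > 0" unfolding ys by auto
  have "sum_list ys = m + sum_list (map (\<lambda>x. x - 1) xs)"
    unfolding ys sum_list_filter_pos by simp
  then show "int (sum_list ys) = int (sum_list xs) + 3 * j - 1"
    using sum_list_pred[OF xs(2)] m by linarith
  \<comment> \<open>If m = 0, the filter drops the new head, but then no part of \<open>xs\<close>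
    exceeds 1 and nothing else survives. The default value of \<open>hd0\<close> keeps
    \<open>hd0 ys = m\<close> true.\<close>
  have "zs = []" if "m = 0"
    unfolding zs_def using mge that by (auto simp: filter_empty_conv)
  then have hd: "hd0 ys = m" and tl: "tl ys = zs"
    by (auto simp: ys zs_def hd0_def)
  have "length zs \<le> length xs" unfolding zs_def by (metis length_filter_le length_map)
  moreover have "length ys \<le> length zs + 1" by (simp add: ys zs_def)
  \<comment> \<open>The image fails the test in \<open>bz\<close>, so the second application takes
    the other branch.\<close>
  ultimately have "\<not> int (hd0 ys) \<le> int (length ys) + 3 * (j - 1)"
    unfolding hd using m by simp
  moreover have "nat (int (hd0 ys) - 3 * (j - 1) - 2) = length xs"
    using m hd by simp
  ultimately have "bz (j - 1, ys) = (j, map Suc zs @ replicate (length xs - length zs) 1)"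
    by (simp add: bz_def tl)
  also have "\<dots> = (j, xs)" using restore_ones[OF xs] by (simp add: zs_def)
  finally show "bz (bz (j, xs)) = (j, xs)" by (simp only: bz')
qed

lemma bz_up:
  assumes xs: "sorted_wrt (\<ge>) xs" "\<forall>x\<in>set xs. x > 0"
    and gt: "\<not> int (hd0 xs) \<le> int (length xs) + 3 * j"
  defines "ys \<equiv> snd (bz (j, xs))"
  shows "fst (bz (j, xs)) = j + 1"
    and "sorted_wrt (\<ge>) ys" and "\<forall>x\<in>set ys. x > 0"
    and "int (sum_list ys) = int (sum_list xs) - 3 * j - 2"
    and "bz (bz (j, xs)) = (j, xs)"
proof -
  define r where "r = nat (int (hd0 xs) - 3 * j - 2) - length (tl xs)"
  \<comment> \<open>Neither \<open>nat\<close> nor the subtraction truncates. For empty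
    \<open>xs\<close> this uses that 3j < 0 forces 3j \<le> -3.\<close>
  have r: "int r = int (hd0 xs) - 3 * j - 2 - int (length (tl xs))"
    using gt by (cases xs) (auto simp: r_def hd0_def)
  have bz: "bz (j, xs) = (j + 1, map Suc (tl xs) @ replicate r 1)"
    using gt by (simp add: bz_def r_def)
  have ys: "ys = map Suc (tl xs) @ replicate r 1"
    using bz by (simp add: ys_def)
  have bz': "bz (j, xs) = (j + 1, ys)" using bz ys by simp
  show "fst (bz (j, xs)) = j + 1" using bz by simp
  have "sorted_wrt (\<ge>) (tl xs)" using xs(1) by (cases xs) auto
  then have "sorted_wrt (\<ge>) (map Suc (tl xs))"
    unfolding sorted_wrt_map by simp
  moreover have "sorted_wrt (\<ge>) (replicate r (1::nat))" by (induction r) auto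
  ultimately show "sorted_wrt (\<ge>) ys" by (auto simp: ys sorted_wrt_append)
  show "\<forall>x\<in>set ys. x > 0" unfolding ys by auto
  have "sum_list ys = sum_list (tl xs) + length (tl xs) + r"
    unfolding ys by (simp add: sum_list_map_Suc sum_list_replicate)
  then show "int (sum_list ys) = int (sum_list xs) - 3 * j - 2"
    using hd0_sum_tl[of xs] r by linarith
  have len: "int (length ys) = int (hd0 xs) - 3 * j - 2"
    using r by (simp add: ys)
  have "\<forall>y\<in>set ys. y \<le> hd0 xs + 1"
    using hd0_ge[OF xs(1)] by (auto simp: ys dest: list.set_sel(2)[rotated])
       (metis list.sel(2) list.set_sel(2))
  then have "hd0 ys \<le> hd0 xs + 1"
    by (cases ys) (auto simp: hd0_def)
  then have "int (hd0 ys) \<le> int (length ys) + 3 * (j + 1)"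
    using len by simp
  moreover have "nat (int (length ys) + 3 * (j + 1) - 1) = hd0 xs"
    using len by simp
  ultimately have "bz (j + 1, ys) = (j, filter (\<lambda>x. x > 0) (hd0 xs # map (\<lambda>x. x - 1) ys))"
    by (simp add: bz_def)
  also have "map (\<lambda>x. x - 1) ys = tl xs @ replicate r 0"
    by (simp add: ys comp_def)
  also have "filter (\<lambda>x. x > 0) (hd0 xs # tl xs @ replicate r 0) = xs"
    using xs(2) by (cases xs) (auto simp: hd0_def filter_id_conv)
  finally show "bz (bz (j, xs)) = (j, xs)" by (simp only: bz')
qed

text \<open>Passing from j to j - 1 lowers j(3j + 1)/2 by 3j - 1, and passing to j + 1 raises it by
  3j + 2; the sum of the parts changes by the opposite amount. Positivity of n rules out the pair
  (0, []).\<close>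

lemma bz_pairs_closed:
  assumes n: "n > 0" and p: "p \<in> bz_pairs n"
  shows "bz p \<in> bz_pairs n" and "bz (bz p) = p" and "even (fst (bz p)) \<longleftrightarrow> odd (fst p)"
proof -
  obtain j xs where p_eq: "p = (j, xs)" by (cases p)
  have xs: "sorted_wrt (\<ge>) xs" "\<forall>x\<in>set xs. x > 0"
    and sum: "2 * int (sum_list xs) + j * (3 * j + 1) = 2 * int n"
    using p by (auto simp: p_eq bz_pairs_def is_partition_def)
  have ne: "xs \<noteq> [] \<or> j \<noteq> 0" using sum n by auto
  have "bz p \<in> bz_pairs n \<and> bz (bz p) = p \<and> (even (fst (bz p)) \<longleftrightarrow> odd (fst p))"
  proof (cases "int (hd0 xs) \<le> int (length xs) + 3 * j")
    case True
    note * = bz_down[OF xs True ne]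
    have "2 * int (sum_list (snd (bz p))) + (j - 1) * (3 * (j - 1) + 1) = 2 * int n"
      using *(4) sum by (simp add: p_eq algebra_simps)
    then show ?thesis using * by (auto simp: p_eq bz_pairs_def is_partition_def case_prod_beta)
  next
    case False
    note * = bz_up[OF xs False]
    have "2 * int (sum_list (snd (bz p))) + (j + 1) * (3 * (j + 1) + 1) = 2 * int n"
      using *(4) sum by (simp add: p_eq algebra_simps)
    then show ?thesis using * by (auto simp: p_eq bz_pairs_def is_partition_def case_prod_beta)
  qed
  then show "bz p \<in> bz_pairs n" and "bz (bz p) = p" and "even (fst (bz p)) \<longleftrightarrow> odd (fst p)"
    by auto
qed

section \<open>Pentagonal numbers and the identity PF = 1\<close>

lemma pentagonal_inj:
  assumes "j * (3 * j + 1) = k * (3 * k + 1)"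
  shows "j = (k::int)"
proof -
  have "(j - k) * (3 * (j + k) + 1) = 0" using assms by (simp add: algebra_simps)
  moreover have "3 * (j + k) + 1 \<noteq> 0" by presburger
  ultimately show ?thesis by simp
qed

lemma pentagonal_nonneg: "j * (3 * j + 1) \<ge> (0::int)"
  by (cases "j \<ge> 0") (auto simp: zero_le_mult_iff)

text \<open>These are the generalized pentagonal numbers, as j may be negative.\<close>

definition pentagonal :: "nat \<Rightarrow> bool" where
  "pentagonal n \<longleftrightarrow> (\<exists>j::int. j * (3 * j + 1) = 2 * int n)"

text \<open>Over \<open>bit\<close> the signs (-1)^j of Euler's pentagonal series disappear.\<close>

definition pent_fps :: "bit fps" where
  "pent_fps = Abs_fps (\<lambda>n. of_bool (pentagonal n))"

definition partition_fps :: "bit fps" where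
  "partition_fps = Abs_fps (\<lambda>n. of_nat (partition_number n))"

definition pent_index :: "nat \<Rightarrow> int" where
  "pent_index n = (SOME j. j * (3 * j + 1) = 2 * int n)"

text \<open>By \<open>pentagonal_inj\<close> the index j is determined by n - i, so the pairs can be
  counted as a Cauchy product.\<close>

lemma bz_pairs_eq:
  "bz_pairs n = (\<lambda>(i, xs). (pent_index (n - i), xs)) `
     (SIGMA i:{i. i \<le> n \<and> pentagonal (n - i)}. {xs. is_partition i xs})" (is "_ = ?f ` ?S")
proof (intro equalityI subsetI)
  fix p assume "p \<in> bz_pairs n"
  then obtain j xs i where p: "p = (j, xs)" "is_partition i xs"
    "2 * int i + j * (3 * j + 1) = 2 * int n" by (auto simp: bz_pairs_def)
  have le: "i \<le> n" using p(3) pentagonal_nonneg[of j] by linarith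
  have j: "j * (3 * j + 1) = 2 * int (n - i)" using p(3) le by simp
  then have "pent_index (n - i) * (3 * pent_index (n - i) + 1) = 2 * int (n - i)"
    unfolding pent_index_def by (rule someI)
  then have "pent_index (n - i) = j" by (rule pentagonal_inj[OF trans[OF _ j[symmetric]]])
  moreover have "pentagonal (n - i)" using j by (auto simp: pentagonal_def)
  ultimately show "p \<in> ?f ` ?S" using p le by (auto intro!: image_eqI[of _ _ "(i, xs)"])
next
  fix p assume "p \<in> ?f ` ?S"
  then obtain i xs where p: "p = (pent_index (n - i), xs)" "i \<le> n" "pentagonal (n - i)"
    "is_partition i xs" by auto
  from p(3) have "pent_index (n - i) * (3 * pent_index (n - i) + 1) = 2 * int (n - i)"
    unfolding pentagonal_def pent_index_def by (rule someI_ex)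
  with p show "p \<in> bz_pairs n" by (auto simp: bz_pairs_def)
qed

lemma card_bz_pairs:
  "card (bz_pairs n) = (\<Sum>i\<le>n. partition_number i * of_bool (pentagonal (n - i)))"
  and finite_bz_pairs: "finite (bz_pairs n)"
proof -
  let ?I = "{i. i \<le> n \<and> pentagonal (n - i)}"
  let ?S = "SIGMA i:?I. {xs. is_partition i xs}"
  have fin: "finite ?I" by (rule finite_subset[of _ "{..n}"]) auto
  have "inj_on (\<lambda>(i, xs). (pent_index (n - i), xs)) ?S"
    by (auto simp: inj_on_def is_partition_def)
  then have "card (bz_pairs n) = card ?S"
    unfolding bz_pairs_eq by (rule card_image)
  also have "\<dots> = (\<Sum>i\<in>?I. partition_number i)"
    using fin finite_partitions by (simp add: card_SigmaI partition_number_def)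
  also have "\<dots> = (\<Sum>i\<le>n. partition_number i * of_bool (pentagonal (n - i)))"
    by (rule sum.mono_neutral_cong_left) auto
  finally show "card (bz_pairs n) = (\<Sum>i\<le>n. partition_number i * of_bool (pentagonal (n - i)))" .
  show "finite (bz_pairs n)"
    unfolding bz_pairs_eq using fin finite_partitions by (intro finite_imageI finite_SigmaI) auto
qed

text \<open>The involution swaps the pairs with even j and those with odd j.\<close>

lemma even_card_bz_pairs:
  assumes n: "n > 0"
  shows "even (card (bz_pairs n))"
proof -
  let ?E = "{p \<in> bz_pairs n. even (fst p)}" and ?O = "{p \<in> bz_pairs n. odd (fst p)}"
  have "bij_betw bz ?E ?O"
    by (rule bij_betw_byWitness[where f' = bz]) (use bz_pairs_closed[OF n] in auto)
  then have "card ?E = card ?O" by (rule bij_betw_same_card)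
  moreover have "bz_pairs n = ?E \<union> ?O" by auto
  then have "card (bz_pairs n) = card ?E + card ?O"
    using finite_bz_pairs[of n]
    by (subst card_Un_disjoint[symmetric]) (auto intro: arg_cong[of _ _ card])
  ultimately show ?thesis by simp
qed

lemma pentagonal_0: "pentagonal 0"
  unfolding pentagonal_def by (rule exI[of _ 0]) simp

lemma of_nat_bit_eq: "(of_nat n :: bit) = of_bool (odd n)"
  by (induction n) auto

lemma partition_mult_pent: "partition_fps * pent_fps = 1"
proof (rule fps_ext)
  fix n
  have "(partition_fps * pent_fps) $ n = of_nat (card (bz_pairs n))"
    by (simp only: fps_mult_nth partition_fps_def pent_fps_def fps_nth_Abs_fps card_bz_pairs
        atLeast0AtMost of_nat_sum of_nat_mult of_nat_of_bool)
  also have "\<dots> = 1 $ n"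
  proof (cases "n = 0")
    case True
    then show ?thesis by (simp add: card_bz_pairs pentagonal_0 partition_number_0)
  next
    case False
    then show ?thesis using even_card_bz_pairs[of n] by (simp add: of_nat_bit_eq)
  qed
  finally show "(partition_fps * pent_fps) $ n = 1 $ n" .
qed

section \<open>Squares of series modulo 2 and extraction of a residue class\<close>

lemma bit_fps_square_nth:
  fixes f :: "bit fps"
  shows "(f * f) $ n = (if even n then f $ (n div 2) else 0)"
proof -
  let ?g = "\<lambda>i. f $ i * f $ (n - i)"
  \<comment> \<open>The reflection of i to n - i swaps \<open>?L\<close> and \<open>?R\<close>,
    whose sums cancel in characteristic 2. The middle term is a square, and each bit equals its
    square.\<close>
  let ?L = "{i. i \<le> n \<and> 2 * i < n}" and ?M = "{i. i \<le> n \<and> 2 * i = n}"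
    and ?R = "{i. i \<le> n \<and> 2 * i > n}"
  have fin: "finite ?L" "finite ?M" "finite ?R" by (auto intro: finite_subset[of _ "{..n}"])
  have "{0..n} = ?L \<union> ?R \<union> ?M" by auto
  \<comment> \<open>stated for arbitrary h, since the simplifier rewrites sums of products of bits to cardinalities\<close>
  then have "sum h {0..n} = sum h ?L + sum h ?R + sum h ?M" for h :: "nat \<Rightarrow> bit"
    using fin by (simp add: sum.union_disjoint Int_Un_distrib2 disjoint_iff)
  then have "(f * f) $ n = sum ?g ?L + sum ?g ?R + sum ?g ?M"
    unfolding fps_mult_nth .
  also have "sum ?g ?R = sum ?g ?L"
    by (rule sum.reindex_bij_witness[of _ "\<lambda>i. n - i" "\<lambda>i. n - i"]) (auto simp: mult.commute)
  also have "sum ?g ?L + sum ?g ?L = 0" by simp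
  also have "?M = (if even n then {n div 2} else {})" by auto
  also have "0 + sum ?g \<dots> = (if even n then f $ (n div 2) else 0)"
  proof (cases "even n")
    case True
    then have nn: "n - n div 2 = n div 2" by auto
    have "sum h {m} = h m" for h :: "nat \<Rightarrow> bit" and m by simp
    then have "sum ?g {n div 2} = ?g (n div 2)" .
    also have "\<dots> = f $ (n div 2) * f $ (n div 2)" using nn by simp
    finally show ?thesis using True by (cases "f $ (n div 2)") simp_all
  qed simp
  finally show ?thesis .
qed

definition section_fps :: "nat \<Rightarrow> bit fps" where
  "section_fps r = Abs_fps (\<lambda>n. of_nat (partition_number (2 * n + r)))"

lemma section_mult_pent_nth:
  assumes "r < 2"
  shows "(section_fps r * pent_fps) $ n = of_bool (pentagonal (2 * n + r))"
proof -
  let ?h = "\<lambda>i. partition_fps $ i * (pent_fps * pent_fps) $ (2 * n + r - i)"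
  have "pent_fps = partition_fps * (pent_fps * pent_fps)"
    using partition_mult_pent by (simp add: mult.assoc[symmetric])
  then have "pent_fps $ (2 * n + r) = (\<Sum>i=0..2 * n + r. ?h i)"
    by (metis fps_mult_nth)
  \<comment> \<open>F^2 has only even exponents, so only the indices i congruent to r modulo 2
    contribute.\<close>
  also have "\<dots> = (\<Sum>i\<in>(\<lambda>i. 2 * i + r) ` {0..n}. ?h i)"
  proof (rule sum.mono_neutral_right)
    show "\<forall>i\<in>{0..2 * n + r} - (\<lambda>i. 2 * i + r) ` {0..n}. ?h i = 0"
    proof
      fix i assume i: "i \<in> {0..2 * n + r} - (\<lambda>i. 2 * i + r) ` {0..n}"
      have "odd (2 * n + r - i)"
      proof
        assume "even (2 * n + r - i)"
        then obtain m where m: "2 * n + r - i = 2 * m" by (elim evenE)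
        then have "i = 2 * (n - m) + r" using i assms by auto
        then show False using i by auto
      qed
      then show "?h i = 0" by (simp add: bit_fps_square_nth)
    qed
  qed auto
  also have "\<dots> = (\<Sum>i=0..n. partition_fps $ (2 * i + r) * pent_fps $ (n - i))"
    by (subst sum.reindex)
      (auto simp: inj_on_def bit_fps_square_nth simp flip: diff_mult_distrib2 intro!: sum.cong)
  also have "\<dots> = (section_fps r * pent_fps) $ n"
    by (simp add: fps_mult_nth section_fps_def partition_fps_def)
  finally show ?thesis by (simp add: pent_fps_def)
qed

section \<open>Gaps between pentagonal numbers\<close>

lemma pentagonal_square: "pentagonal n \<Longrightarrow> \<exists>x::int. x\<^sup>2 = 24 * int n + 1"
  unfolding pentagonal_def
proof (elim exE)
  fix j :: int assume "j * (3 * j + 1) = 2 * int n"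
  then have "(6 * j + 1)\<^sup>2 = 24 * int n + 1" by (simp add: power2_eq_square algebra_simps)
  then show ?thesis ..
qed

text \<open>Multiplying by 24 and adding 1 turns pentagonal numbers into squares of numbers 6j + 1.
  After 6k + 1 the next absolute value is 6k + 5, and the squares differ by 24(2k + 1), more than
  24d.\<close>

lemma pentagonal_gap:
  assumes k: "2 * w = k * (3 * k + 1)" and d: "0 < d" "d \<le> k"
  shows "\<not> pentagonal (w + d)"
proof
  assume "pentagonal (w + d)"
  then obtain j :: int where j: "j * (3 * j + 1) = 2 * int (w + d)"
    unfolding pentagonal_def by blast
  have w: "2 * int w = int k * (3 * int k + 1)"
    using arg_cong[OF k, of int] by (simp only: of_nat_mult of_nat_add of_nat_numeral of_nat_1)
  have eq: "(6 * j + 1)\<^sup>2 = (6 * int k + 1)\<^sup>2 + 24 * int d"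
    using j w by (simp add: power2_eq_square algebra_simps)
  have "(6 * int k + 1)\<^sup>2 < (6 * j + 1)\<^sup>2" using eq d by simp
  then have "\<bar>6 * int k + 1\<bar> < \<bar>6 * j + 1\<bar>"
    by (simp only: abs_le_square_iff not_le[symmetric] not_False_eq_True)
  then have "\<bar>6 * j + 1\<bar> \<ge> 6 * int k + 5" by presburger
  then have "(6 * j + 1)\<^sup>2 \<ge> (6 * int k + 5)\<^sup>2"
    by (metis abs_le_square_iff abs_of_nonneg add_nonneg_nonneg mult_nonneg_nonneg
        of_nat_0_le_iff zero_le_numeral)
  then show False using eq d by (simp add: power2_eq_square algebra_simps)
qed

lemma finite_support_mult_pent:
  assumes c: "finite {n. c $ n \<noteq> 0}" "c \<noteq> 0"
  obtains N where "\<And>k w. k \<ge> N \<Longrightarrow> 2 * w = k * (3 * k + 1) \<Longrightarrow> (c * pent_fps) $ (N + w) = 1"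
proof
  \<comment> \<open>N is the degree of c and also the bound for k: for i < N the shift N - i is at
    most k, so the term of index i falls into the gap above w.\<close>
  define N where "N = Max {n. c $ n \<noteq> 0}"
  have "{n. c $ n \<noteq> 0} \<noteq> {}" using c(2) by (auto simp: fps_eq_iff)
  then have N: "c $ N \<noteq> 0" using Max_in[OF c(1)] by (auto simp: N_def)
  have gt: "c $ n = 0" if "n > N" for n
    using Max_ge[OF c(1), of n] that unfolding N_def by force
  fix k w assume k: "k \<ge> N" "2 * w = k * (3 * k + 1)"
  have pw: "pentagonal w"
    unfolding pentagonal_def by (rule exI[of _ "int k"])
      (use arg_cong[OF k(2), of int] in \<open>simp add: algebra_simps\<close>)
  have "(c * pent_fps) $ (N + w) = (\<Sum>i=0..N + w. c $ i * pent_fps $ (N + w - i))"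
    by (rule fps_mult_nth)
  also have "\<dots> = (\<Sum>i\<in>{N}. c $ i * pent_fps $ (N + w - i))"
  proof (rule sum.mono_neutral_right)
    show "\<forall>i\<in>{0..N + w} - {N}. c $ i * pent_fps $ (N + w - i) = 0"
    proof
      fix i assume "i \<in> {0..N + w} - {N}"
      then consider "i > N" | "i < N" by fastforce
      then show "c $ i * pent_fps $ (N + w - i) = 0"
      proof cases
        case 2
        then show ?thesis using pentagonal_gap[OF k(2), of "N - i"] k(1)
          by (simp add: pent_fps_def add.commute)
      qed (simp add: gt)
    qed
  qed auto
  also have "\<dots> = 1" using N pw by (simp add: pent_fps_def)
  finally show "(c * pent_fps) $ (N + w) = 1" .
qed

section \<open>Avoiding squares by congruence conditions on k\<close>

lemma square_mod:
  assumes "(x::int)\<^sup>2 = M + 24 * (k * (3 * k + 1))"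
  shows "(M mod p + 24 * (k mod p * (3 * (k mod p) + 1))) mod p = (x mod p)\<^sup>2 mod p"
proof -
  have "(M mod p + 24 * (k mod p * (3 * (k mod p) + 1))) mod p = (M + 24 * (k * (3 * k + 1))) mod p"
    by (intro mod_add_cong mod_mult_cong) auto
  then show ?thesis using assms by (simp add: power_mod)
qed

text \<open>
  The analogue modulo 7 fails: there M + 24k(3k + 1) can be a square for every k.
\<close>

lemma nonsquare_mod_5:
  obtains u :: nat where "\<And>(x::int) k. k mod 5 = int u mod 5 \<Longrightarrow> x\<^sup>2 \<noteq> M + 24 * (k * (3 * k + 1))"
proof -
  have "\<forall>m\<in>set [0..4]. \<exists>u\<in>set [0..<5]. \<forall>x\<in>set [0..4].
          (m + 24 * (int u mod 5 * (3 * (int u mod 5) + 1))) mod 5 \<noteq> x\<^sup>2 mod 5"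
    by code_simp
  moreover have r: "x mod 5 \<in> set [0..4]" for x :: int by simp
  ultimately obtain u where
    "\<forall>x\<in>set [0..4]. (M mod 5 + 24 * (int u mod 5 * (3 * (int u mod 5) + 1))) mod 5 \<noteq> x\<^sup>2 mod 5"
    by meson
  with r show thesis using square_mod[of _ M _ 5] that by metis
qed

text \<open>Here M + 24k(3k + 1) = 2(6k + 1)^2 + M - 2, and 2 is a nonresidue modulo 11, as it is
  modulo 5. A second modulus coprime to 5 lets two conditions on k hold together.\<close>

lemma nonsquare_mod_11:
  obtains u :: nat where "\<And>(x::int) k. k mod 11 = int u mod 11 \<Longrightarrow> x\<^sup>2 \<noteq> M + 24 * (k * (3 * k + 1))"
proof -
  \<comment> \<open>Exhaustive check over the residues of M, k and x.\<close>
  have "\<forall>m\<in>set [0..10]. \<exists>u\<in>set [0..<11]. \<forall>x\<in>set [0..10].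
          (m + 24 * (int u mod 11 * (3 * (int u mod 11) + 1))) mod 11 \<noteq> x\<^sup>2 mod 11"
    by code_simp
  moreover have r: "x mod 11 \<in> set [0..10]" for x :: int by simp
  ultimately obtain u where
    "\<forall>x\<in>set [0..10]. (M mod 11 + 24 * (int u mod 11 * (3 * (int u mod 11) + 1))) mod 11 \<noteq> x\<^sup>2 mod 11"
    by meson
  with r show thesis using square_mod[of _ M _ 11] that by metis
qed

lemma mult_pent_nonsquare:
  assumes "finite {n. c $ n \<noteq> 0}" "c \<noteq> 0"
  obtains n where "n > 0" "(c * pent_fps) $ n = 1"
    "\<And>x::int. x\<^sup>2 \<noteq> 48 * int n + L" "\<And>x::int. x\<^sup>2 \<noteq> 48 * int n + M"
proof -
  obtain N where N: "\<And>k w. k \<ge> N \<Longrightarrow> 2 * w = k * (3 * k + 1) \<Longrightarrow> (c * pent_fps) $ (N + w) = 1"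
    using finite_support_mult_pent[OF assms] by blast
  obtain u where u: "\<And>(x::int) k. k mod 5 = int u mod 5 \<Longrightarrow> x\<^sup>2 \<noteq> 48 * int N + L + 24 * (k * (3 * k + 1))"
    using nonsquare_mod_5 by blast
  obtain v where v: "\<And>(x::int) k. k mod 11 = int v mod 11 \<Longrightarrow> x\<^sup>2 \<noteq> 48 * int N + M + 24 * (k * (3 * k + 1))"
    using nonsquare_mod_11 by blast
  \<comment> \<open>Chinese remainders: 11 is 1 modulo 5, and 45 is 0 modulo 5 and 1 modulo 11. The
    multiple of 55 makes k positive and at least N.\<close>
  define k where "k = 55 * (N + 1) + 11 * u + 45 * v"
  have "int k = int u + 5 * int (11 * (N + 1) + 2 * u + 9 * v)"
    by (simp add: k_def)
  then have k5: "int k mod 5 = int u mod 5" by (metis mod_mult_self2)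
  have "int k = int v + 11 * int (5 * (N + 1) + u + 4 * v)"
    by (simp add: k_def)
  then have k11: "int k mod 11 = int v mod 11" by (metis mod_mult_self2)
  have "even (k * (3 * k + 1))" by simp
  then obtain w where w: "2 * w = k * (3 * k + 1)" by (metis evenE)
  have w': "48 * int (N + w) = 48 * int N + 24 * (int k * (3 * int k + 1))"
    using arg_cong[OF w, of int] by (simp add: algebra_simps)
  show thesis
  proof
    have "k \<ge> N" "k > 0" by (simp_all add: k_def)
    then show "N + w > 0" "(c * pent_fps) $ (N + w) = 1"
      using w N by (auto intro: gr0I)
    fix x :: int
    show "x\<^sup>2 \<noteq> 48 * int (N + w) + L"
      using u[of "int k" x] unfolding w' by (simp add: k5 algebra_simps)
    show "x\<^sup>2 \<noteq> 48 * int (N + w) + M"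
      using v[of "int k" x] unfolding w' by (simp add: k11 algebra_simps)
  qed
qed

section \<open>Both parities occur infinitely often in each section\<close>

lemma infinite_parity:
  assumes r: "r < 2" and one: "partition_number r = 1"
  shows "infinite {n. n > 0 \<and> odd (partition_number (2 * n + r))}"
    and "infinite {n. n > 0 \<and> even (partition_number (2 * n + r))}"
proof -
  let ?s = "section_fps r"
  let ?M = "24 * int r + 1"
  \<comment> \<open>The constant coefficient makes both A and (1 - q)A nonzero.\<close>
  have s0: "?s $ 0 = 1" using one by (simp add: section_fps_def)
  have s_nth: "?s $ n = of_bool (odd (partition_number (2 * n + r)))" for n
    by (simp add: section_fps_def of_nat_bit_eq)
  have nth: "\<exists>x::int. x\<^sup>2 = 48 * int n + ?M" if "(?s * pent_fps) $ n \<noteq> 0" for n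
  proof -
    have "pentagonal (2 * n + r)"
      using that by (simp add: section_mult_pent_nth[OF r] split: if_splits)
    from pentagonal_square[OF this] show ?thesis by (simp add: algebra_simps)
  qed
  show "infinite {n. n > 0 \<and> odd (partition_number (2 * n + r))}" (is "infinite ?O")
  proof
    assume "finite ?O"
    moreover have "{n. ?s $ n \<noteq> 0} \<subseteq> insert 0 ?O" by (auto simp: s_nth)
    ultimately have "finite {n. ?s $ n \<noteq> 0}" by (meson finite_insert finite_subset)
    moreover have "?s \<noteq> 0" using s0 by auto
    \<comment> \<open>Only one nonsquare condition is wanted here, so the same constant is passed
      twice.\<close>
    ultimately obtain n where "(?s * pent_fps) $ n = 1" "\<And>x::int. x\<^sup>2 \<noteq> 48 * int n + ?M"
      using mult_pent_nonsquare[of ?s ?M ?M] by blast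
    then show False using nth[of n] by auto
  qed
  show "infinite {n. n > 0 \<and> even (partition_number (2 * n + r))}" (is "infinite ?E")
  proof
    assume fin: "finite ?E"
    define c where "c = (1 - fps_X) * ?s"
    have c_nth: "c $ n = ?s $ n - (if n = 0 then 0 else ?s $ (n - 1))" for n
      by (simp add: c_def left_diff_distrib)
    \<comment> \<open>For n > 1 a nonzero difference of neighbouring coefficients needs one of them
      to be zero, that is, n or n - 1 in \<open>?E\<close>.\<close>
    have "{n. c $ n \<noteq> 0} \<subseteq> insert 0 (insert 1 (?E \<union> Suc ` ?E))"
    proof
      fix n assume n: "n \<in> {n. c $ n \<noteq> 0}"
      show "n \<in> insert 0 (insert 1 (?E \<union> Suc ` ?E))"
      proof (rule ccontr)
        assume *: "n \<notin> insert 0 (insert 1 (?E \<union> Suc ` ?E))"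
        then obtain m where "n = Suc m" "m > 0" by (cases n) auto
        then show False using * n by (auto simp: c_nth s_nth)
      qed
    qed
    then have "finite {n. c $ n \<noteq> 0}" by (rule finite_subset) (use fin in auto)
    moreover have "c \<noteq> 0" using s0 c_nth[of 0] by auto
    ultimately obtain n where n: "n > 0" "(c * pent_fps) $ n = 1"
      "\<And>x::int. x\<^sup>2 \<noteq> 48 * int n + ?M" "\<And>x::int. x\<^sup>2 \<noteq> 48 * int n + (?M - 48)"
      using mult_pent_nonsquare[of c ?M "?M - 48"] by blast
    \<comment> \<open>The coefficient of (1 - q)AF at n involves those of AF at n and n - 1; the
      constant \<open>?M - 48\<close> handles the latter.\<close>
    have "48 * int (n - 1) + ?M = 48 * int n + (?M - 48)"
      using n(1) by (simp add: of_nat_diff)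
    then have "(?s * pent_fps) $ n = 0" "(?s * pent_fps) $ (n - 1) = 0"
      using nth[of n] nth[of "n - 1"] n(3,4) by (blast, metis)
    then have "(c * pent_fps) $ n = 0"
      using n(1) by (simp add: c_def left_diff_distrib mult.assoc)
    with n(2) show False by simp
  qed
qed

lemma partition_number_1: "partition_number 1 = 1"
proof -
  have "xs = [1]" if "is_partition 1 xs" for xs
    using that by (cases xs; cases "tl xs") (auto simp: is_partition_def)
  moreover have "is_partition 1 [1]" by (simp add: is_partition_def)
  ultimately have "{xs. is_partition 1 xs} = {[1]}" by blast
  then show ?thesis by (simp add: partition_number_def)
qed

theorem corollary2:
  shows "infinite {n::nat. n > 0 \<and> even (partition_number (2 * n))}
    \<and> infinite {n::nat. n > 0 \<and> odd (partition_number (2 * n))}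
    \<and> infinite {n::nat. n > 0 \<and> even (partition_number (2 * n + 1))}
    \<and> infinite {n::nat. n > 0 \<and> odd (partition_number (2 * n + 1))}"
  using infinite_parity[of 0] infinite_parity[of 1] partition_number_0 partition_number_1
  by simp

end
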